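(* Let $\alpha \ge 0$. The index transform $$F_\alpha(\tau) = \int_0^\infty \left| K_{(i\tau+ \alpha)/2}(x)\right|^2 f(x)\,dx,\qquad \tau\in\mathbb{R},$$ is well-defined as a bounded operator $f\mapsto F_\alpha$ from $L^\alpha$ into the space $C_0(\mathbb{R})$ of bounded continuous functions vanishing at infinity. Moreover, for $f\in L^\alpha$ the following composition representation holds: $$F_\alpha(\tau)= \int_{-\infty}^{\infty} (\mathcal{K}_\alpha f)(2\cosh t)\, e^{i\tau t}\,dt,\qquad \tau\in\mathbb{R},$$ that is, $F_\alpha$ is the Fourier transform $(\mathcal{F}h)(\tau)=\int_{-\infty}^\infty h(t)e^{i\tau t}dt$ of the function $h(t)=(\mathcal{K}_\alpha f)(2\cosh t)$.
   Context: $K_\mu(z)$ is the Macdonald function (modified Bessel function of the second kind), $K_\mu(z)=\int_0^\infty e^{-z\cosh u}\cosh(\mu u)\,du$ for $\mathrm{Re}\,z>0$, $\mu\in\mathbb{C}$. $\mathbb{R}_+=(0,\infty)$. $L^\alpha = L_1(\mathbb{R}_+;K_{\alpha/2}^2(x)dx)$ is the space of functions $f$ with $\|f\|_{L^\alpha}=\int_0^\infty K_{\alpha/2}^2(x)|f(x)|dx<\infty$. The space $C_0(\mathbb{R})$ carries the supremum norm. The Meijer $K$-transform is $(\mathcal{K}_\alpha f)(x)=\int_0^\infty K_\alpha(xt)f(t)\,dt$. *)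

theory Defs
  imports "HOL-Analysis.Analysis"
begin

(* One definition serves both real and complex arguments; see macdonald_of_real below.
   The integral converges absolutely for every order m if z > 0 (resp. Re z > 0). *)
definition macdonald ::
    "'a::{real_normed_field, banach, second_countable_topology} \<Rightarrow> 'a \<Rightarrow> 'a" where
  "macdonald m z =
    (LINT u:{0<..}|lebesgue. exp (- (z * cosh (of_real u))) * cosh (m * of_real u))"

lemma macdonald_of_real:
  "macdonald (complex_of_real m) (complex_of_real x) = complex_of_real (macdonald m x)"
proof -
  have "cosh (complex_of_real y) = complex_of_real (cosh y)" for y
    by (simp add: cosh_def exp_of_real scaleR_conv_of_real flip: of_real_minus)
  then have "exp (- (complex_of_real x * cosh (complex_of_real u))) * cosh (complex_of_real m * complex_of_real u)
      = complex_of_real (exp (- (x * cosh u)) * cosh (m * u))" for u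
    by (simp add: exp_of_real flip: of_real_mult of_real_minus)
  then show ?thesis
    unfolding macdonald_def of_real_eq_id id_apply
    by (simp only: set_integral_complex_of_real)
qed

(* The elements are functions, not classes modulo equality almost everywhere;
   values outside the positive half-line play no role. *)
definition L_space :: "real \<Rightarrow> (real \<Rightarrow> complex) set" where
  "L_space \<alpha> = {f. set_borel_measurable lebesgue {0<..} f \<and>
     set_integrable lebesgue {0<..} (\<lambda>x. (macdonald (\<alpha>/2) x)\<^sup>2 * cmod (f x))}"

definition L_norm :: "real \<Rightarrow> (real \<Rightarrow> complex) \<Rightarrow> real" where
  "L_norm \<alpha> f = (LINT x:{0<..}|lebesgue. (macdonald (\<alpha>/2) x)\<^sup>2 * cmod (f x))"

definition C0_space :: "(real \<Rightarrow> complex) set" where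
  "C0_space = {g \<in> bcontfun. (g \<longlongrightarrow> 0) at_infinity}"

definition sup_norm :: "(real \<Rightarrow> complex) \<Rightarrow> real" where
  "sup_norm g = (SUP \<tau>. cmod (g \<tau>))"

definition bounded_operator ::
    "('a \<Rightarrow> complex) set \<Rightarrow> (('a \<Rightarrow> complex) \<Rightarrow> real) \<Rightarrow>
     ('b \<Rightarrow> complex) set \<Rightarrow> (('b \<Rightarrow> complex) \<Rightarrow> real) \<Rightarrow>
     (('a \<Rightarrow> complex) \<Rightarrow> 'b \<Rightarrow> complex) \<Rightarrow> bool" where
  "bounded_operator X nX Y nY T \<longleftrightarrow>
     (\<forall>f\<in>X. T f \<in> Y) \<and>
     (\<forall>f\<in>X. \<forall>g\<in>X. \<forall>a b. T (\<lambda>x. a * f x + b * g x) = (\<lambda>y. a * T f y + b * T g y)) \<and>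
     (\<exists>C. \<forall>f\<in>X. nY (T f) \<le> C * nX f)"

definition index_kernel :: "real \<Rightarrow> real \<Rightarrow> real \<Rightarrow> real" where
  "index_kernel \<alpha> \<tau> x =
     (cmod (macdonald ((\<i> * complex_of_real \<tau> + complex_of_real \<alpha>) / 2) (complex_of_real x)))\<^sup>2"

definition index_transform :: "real \<Rightarrow> (real \<Rightarrow> complex) \<Rightarrow> real \<Rightarrow> complex" where
  "index_transform \<alpha> f \<tau> =
     (LINT x:{0<..}|lebesgue. complex_of_real (index_kernel \<alpha> \<tau> x) * f x)"

definition meijer_K_transform :: "real \<Rightarrow> (real \<Rightarrow> complex) \<Rightarrow> real \<Rightarrow> complex" where
  "meijer_K_transform \<alpha> f x =
     (LINT t:{0<..}|lebesgue. complex_of_real (macdonald \<alpha> (x * t)) * f t)"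

definition fourier_transform :: "(real \<Rightarrow> complex) \<Rightarrow> real \<Rightarrow> complex" where
  "fourier_transform h \<tau> =
     (LINT t|lebesgue. h t * exp (\<i> * complex_of_real \<tau> * complex_of_real t))"

end

theory Submission
  imports Defs
begin

text \<open>
  The theorem rests on a product formula. For real \<open>x > 0\<close> the even extension of the defining integral is
  \<open>K\<^sub>\<mu>(x) = 1/2 \<integral> exp (\<mu> u - x cosh u) du\<close> over the whole real line, so \<open>K\<^sub>\<mu>(x) K\<^sub>\<nu>(x)\<close> is a double integral in
  \<open>u, v\<close>. In the coordinates \<open>u = s + t\<close>, \<open>v = s - t\<close> one has \<open>cosh u + cosh v = 2 cosh s cosh t\<close> and
  \<open>\<mu> u + \<nu> v = (\<mu> + \<nu>) s + (\<mu> - \<nu>) t\<close>, and the integration over \<open>s\<close> is again a Macdonald integral: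
  \<open>K\<^sub>\<mu>(x) K\<^sub>\<nu>(x) = \<integral> K\<^bsub>\<mu>+\<nu>\<^esub>(2 x cosh t) exp ((\<mu> - \<nu>) t) dt\<close> (\<open>macdonald_mult_macdonald\<close>).

  With \<open>\<mu> = (\<i> \<tau> + \<alpha>)/2\<close> and \<open>\<nu>\<close> its conjugate this writes the index kernel as a Fourier transform in \<open>\<tau>\<close> of
  \<open>K\<^sub>\<alpha>(2 x cosh t)\<close> (\<open>index_kernel_eq_fourier\<close>). At \<open>\<tau> = 0\<close> it says
  \<open>\<integral> K\<^sub>\<alpha>(2 x cosh t) dt = K\<^bsub>\<alpha>/2\<^esub>(x)\<^sup>2\<close>, and the right-hand side is exactly the weight of the space \<open>L\<^sup>\<alpha>\<close>. Hence
  \<open>K\<^sub>\<alpha>(2 x cosh t) f(x)\<close> is absolutely integrable in \<open>(x, t)\<close> if \<open>f\<close> lies in \<open>L\<^sup>\<alpha>\<close>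
  (\<open>integrable_pair_macdonald_cosh\<close>), and Fubini's theorem yields the composition representation.

  The mapping property follows. The kernel is bounded by the weight, because
  \<open>|K\<^sub>\<mu>(x)| \<le> K\<^bsub>Re \<mu>\<^esub>(x)\<close>, which gives the operator bound with constant 1. Continuity in \<open>\<tau>\<close> is that of the Fourier
  transform of an integrable function. For fixed \<open>x\<close> the kernel tends to 0 as \<open>\<tau>\<close> grows, by the
  Riemann-Lebesgue argument applied to the explicit integrand of \<open>K\<^bsub>(\<i>\<tau>+\<alpha>)/2\<^esub>(x)\<close>, and dominated
  convergence carries the decay over to \<open>F\<^sub>\<alpha>\<close>.
\<close>

section \<open>The Macdonald function as an integral over the real line\<close>

definition macdonald_integrand ::
    "'a::{real_normed_field, banach, second_countable_topology} \<Rightarrow> real \<Rightarrow> real \<Rightarrow> 'a" where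
  "macdonald_integrand m x u = exp (m * of_real u - of_real (x * cosh u))"

lemma cosh_of_real:
  "cosh (of_real u :: 'a::{real_normed_field, banach}) = of_real (cosh u)"
  by (simp add: cosh_def exp_of_real scaleR_conv_of_real flip: of_real_minus)

lemma continuous_on_macdonald_integrand: "continuous_on A (macdonald_integrand m x)"
  unfolding macdonald_integrand_def by (intro continuous_intros)

lemma borel_measurable_macdonald_integrand [measurable]:
  "macdonald_integrand m x \<in> borel_measurable borel"
  by (intro borel_measurable_continuous_onI continuous_on_macdonald_integrand)

lemma integrable_exp_minus_abs: "integrable lborel (\<lambda>u::real. exp (- \<bar>u\<bar>))"
proof -
  have "set_integrable lebesgue {0..} (\<lambda>u::real. exp (- 1 * u))"
    by (intro nonnegative_absolutely_integrable_1 integrable_on_exp_minus_to_infinity) auto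
  then have half: "integrable lborel (\<lambda>u::real. indicator {0..} u *\<^sub>R exp (- u))"
    unfolding set_integrable_def by (subst (asm) integrable_completion) auto
  have "integrable lborel (\<lambda>u::real. indicator {0..} (0 + (-1) * u) *\<^sub>R exp (- (0 + (-1) * u)))"
    using lborel_integrable_real_affine[OF half, of "-1" 0] by simp
  from Bochner_Integration.integrable_add[OF half this] show ?thesis
    by (rule Bochner_Integration.integrable_bound) (auto simp: indicator_def)
qed

lemma cosh_ge_quadratic: "u\<^sup>2 / 4 \<le> cosh (u::real)"
proof -
  have "1 + \<bar>u\<bar> + \<bar>u\<bar>\<^sup>2 / 2 \<le> exp \<bar>u\<bar>"
    by (rule exp_lower_Taylor_quadratic) simp
  moreover have "exp \<bar>u\<bar> \<le> 2 * cosh u"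
    unfolding cosh_def by (cases "u \<ge> 0") auto
  ultimately show ?thesis by simp
qed

text \<open>
  Completing the square in \<open>x u\<^sup>2/4 - (c + 1)|u|\<close>: the quadratic lower bound on \<open>cosh\<close> absorbs a linear
  exponent of any slope and still leaves the decay \<open>- |u|\<close>.
\<close>
lemma linear_minus_cosh_le:
  assumes "x > 0"
  shows "c * \<bar>u\<bar> - x * cosh u \<le> (c + 1)\<^sup>2 / x - \<bar>u::real\<bar>"
proof -
  have "0 \<le> x / 4 * (\<bar>u\<bar> - 2 * (c + 1) / x)\<^sup>2"
    using assms by simp
  also have "\<dots> = x * (u\<^sup>2 / 4) - (c + 1) * \<bar>u\<bar> + (c + 1)\<^sup>2 / x"
    using assms by (simp add: power2_eq_square field_simps)
  also have "x * (u\<^sup>2 / 4) \<le> x * cosh u"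
    using assms cosh_ge_quadratic by (intro mult_left_mono) auto
  finally show ?thesis by (simp add: algebra_simps)
qed

lemma integrable_macdonald_integrand:
  assumes "x > 0"
  shows "integrable lborel (macdonald_integrand m x)"
proof (rule Bochner_Integration.integrable_bound)
  let ?C = "exp ((norm m + 1)\<^sup>2 / x)"
  show "integrable lborel (\<lambda>u. ?C * exp (- \<bar>u\<bar>))"
    by (intro integrable_mult_right integrable_exp_minus_abs)
  show "AE u in lborel. norm (macdonald_integrand m x u) \<le> norm (?C * exp (- \<bar>u\<bar>))"
  proof (intro AE_I2)
    fix u :: real
    have "norm (macdonald_integrand m x u) = norm (exp (m * of_real u)) * exp (- (x * cosh u))"
      unfolding macdonald_integrand_def
      by (simp add: exp_diff exp_minus norm_mult norm_inverse exp_of_real divide_inverse del: of_real_mult)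
    also have "norm (exp (m * of_real u)) \<le> exp (norm m * \<bar>u\<bar>)"
      using norm_exp[of "m * of_real u"] by (simp add: norm_mult)
    also have "exp (norm m * \<bar>u\<bar>) * exp (- (x * cosh u)) = exp (norm m * \<bar>u\<bar> - x * cosh u)"
      by (simp add: exp_diff exp_minus divide_inverse)
    also have "\<dots> \<le> exp ((norm m + 1)\<^sup>2 / x - \<bar>u\<bar>)"
      using linear_minus_cosh_le[OF assms] by simp
    also have "\<dots> = norm (?C * exp (- \<bar>u\<bar>))"
      by (simp add: exp_diff exp_minus divide_inverse)
    finally show "norm (macdonald_integrand m x u) \<le> norm (?C * exp (- \<bar>u\<bar>))" by simp
  qed
qed simp

text \<open>
  The integrand is Borel, so the passage from the completed measure to Borel-Lebesgue measure is free; the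
  latter is the one for which product measures and parametrised integrals are measurable.
\<close>
lemma macdonald_eq_lborel:
  "macdonald m z =
    (LINT u|lborel. indicator {0<..} u *\<^sub>R (exp (- (z * cosh (of_real u))) * cosh (m * of_real u)))"
  unfolding macdonald_def set_lebesgue_integral_def
  by (rule integral_completion) (simp add: cosh_def)

lemma borel_measurable_macdonald [measurable]: "macdonald m \<in> borel_measurable borel"
  unfolding macdonald_eq_lborel[abs_def] by (simp add: cosh_def)

text \<open>
  Expanding \<open>cosh (m u)\<close> into exponentials splits the half-line integrand into the values of the two-sided
  integrand at \<open>u\<close> and \<open>- u\<close>.
\<close>
lemma macdonald_eq_integral_real_line:
  fixes m :: "'a::{real_normed_field, banach, second_countable_topology}"
  assumes "x > 0"
  shows "macdonald m (of_real x) = (LINT u|lborel. macdonald_integrand m x u) / 2"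
proof -
  let ?G = "macdonald_integrand m x" and ?pos = "{0<..} :: real set"
  note G = integrable_macdonald_integrand[OF assms, of m]
  have refl: "integrable lborel (\<lambda>u. ?G (- u))"
    using lborel_integrable_real_affine[OF G, of "-1" 0] by simp
  have pos: "integrable lborel (\<lambda>u. indicator ?pos u *\<^sub>R ?G u)"
    "integrable lborel (\<lambda>u. indicator ?pos u *\<^sub>R ?G (- u))"
    using integrable_mult_indicator[OF _ G, of ?pos] integrable_mult_indicator[OF _ refl, of ?pos] by auto
  have neg: "integrable lborel (\<lambda>u. indicator {..<0} u *\<^sub>R ?G u)"
    using integrable_mult_indicator[OF _ G, of "{..<0}"] by auto
  have "exp (- (of_real x * cosh (of_real u))) * cosh (m * of_real u) = (?G u + ?G (- u)) / 2" for u
    unfolding macdonald_integrand_def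
    by (simp add: cosh_of_real cosh_def[of "m * of_real u"] exp_diff exp_minus field_simps
        scaleR_conv_of_real)
  then have "macdonald m (of_real x) = (LINT u|lborel. indicator ?pos u *\<^sub>R ((?G u + ?G (- u)) / 2))"
    unfolding macdonald_eq_lborel by presburger
  also have "\<dots> = (LINT u|lborel. (indicator ?pos u *\<^sub>R ?G u + indicator ?pos u *\<^sub>R ?G (- u)) / 2)"
    by (intro Bochner_Integration.integral_cong) (auto simp: indicator_def)
  also have "\<dots> = ((LINT u|lborel. indicator ?pos u *\<^sub>R ?G u)
      + (LINT u|lborel. indicator ?pos u *\<^sub>R ?G (- u))) / 2"
    using pos by simp
  also have "(LINT u|lborel. indicator ?pos u *\<^sub>R ?G (- u)) = (LINT u|lborel. indicator {..<0} u *\<^sub>R ?G u)"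
    by (subst (2) lborel_integral_real_affine[where c = "-1" and t = 0])
       (auto intro!: Bochner_Integration.integral_cong simp: indicator_def)
  also have "(LINT u|lborel. indicator ?pos u *\<^sub>R ?G u) + (LINT u|lborel. indicator {..<0} u *\<^sub>R ?G u)
      = (LINT u|lborel. indicator ?pos u *\<^sub>R ?G u + indicator {..<0} u *\<^sub>R ?G u)"
    using pos neg by simp
  also have "\<dots> = (LINT u|lborel. ?G u)"
    by (rule integral_cong_AE)
       (auto intro!: eventually_mono[OF AE_lborel_singleton[of 0]] simp: indicator_def)
  finally show ?thesis .
qed

lemma norm_macdonald_le:
  assumes "x > 0"
  shows "cmod (macdonald m (complex_of_real x)) \<le> macdonald (Re m) x"
proof -
  have "cmod (LINT u|lborel. macdonald_integrand m x u) \<le> (LINT u|lborel. cmod (macdonald_integrand m x u))"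
    by (rule integral_norm_bound)
  also have "\<dots> = (LINT u|lborel. macdonald_integrand (Re m) x u)"
    by (simp add: macdonald_integrand_def)
  finally show ?thesis
    unfolding macdonald_eq_integral_real_line[OF assms, of m]
      macdonald_eq_integral_real_line[OF assms, of "Re m", unfolded of_real_eq_id id_apply]
    by (simp add: norm_divide)
qed

lemma macdonald_nonneg:
  assumes "x > 0"
  shows "0 \<le> macdonald (m::real) x"
  using norm_macdonald_le[OF assms, of "complex_of_real m"] norm_ge_zero
  by (metis Re_complex_of_real order_trans)

lemma cnj_macdonald:
  assumes "x > 0"
  shows "cnj (macdonald m (complex_of_real x)) = macdonald (cnj m) (complex_of_real x)"
proof -
  have "cnj (macdonald_integrand m x u) = macdonald_integrand (cnj m) x u" for u
    by (simp add: macdonald_integrand_def exp_cnj)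
  then show ?thesis
    by (simp add: macdonald_eq_integral_real_line[OF assms] flip: Bochner_Integration.integral_cnj)
qed

section \<open>The product formula\<close>

text \<open>
  The rotation \<open>u = s + t\<close>, \<open>v = s - t\<close> is performed as two affine substitutions in one variable each: first
  \<open>v = u - 2t\<close> for fixed \<open>u\<close>, then, after exchanging the integrals, \<open>u = s + t\<close> for fixed \<open>t\<close>. The factor
  2 of the first one is the Jacobian.
\<close>
lemma macdonald_mult_macdonald:
  fixes \<mu> \<nu> :: complex
  assumes x: "x > 0"
  defines "h \<equiv> \<lambda>t. macdonald (\<mu> + \<nu>) (complex_of_real (2 * cosh t * x)) * exp ((\<mu> - \<nu>) * of_real t)"
  shows "integrable lborel h"
    and "macdonald \<mu> (complex_of_real x) * macdonald \<nu> (complex_of_real x) = (LINT t|lborel. h t)"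
proof -
  let ?G = "macdonald_integrand \<mu> x" and ?H = "macdonald_integrand \<nu> x"
  let ?F = "\<lambda>u t. ?G u * ?H (u - 2 * t)"
  note G = integrable_macdonald_integrand[OF x, of \<mu>] and H = integrable_macdonald_integrand[OF x, of \<nu>]
  have H_aff: "integrable lborel (\<lambda>t. ?H (u - 2 * t))" for u
    using lborel_integrable_real_affine[OF H, of "-2" u] by simp
  have nH: "(LINT t|lborel. cmod (?H (u - 2 * t))) = (LINT t|lborel. cmod (?H t)) / 2" for u
    by (subst (2) lborel_integral_real_affine[where c = "-2" and t = u]) auto
  have iH: "(LINT t|lborel. ?H (u - 2 * t)) = (LINT t|lborel. ?H t) / 2" for u
    by (subst (2) lborel_integral_real_affine[where c = "-2" and t = u]) (auto simp: scaleR_conv_of_real)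
  have F: "integrable (lborel \<Otimes>\<^sub>M lborel) (\<lambda>(u, t). ?F u t)"
  proof (rule lborel_pair.Fubini_integrable)
    show "(\<lambda>(u, t). ?F u t) \<in> borel_measurable (lborel \<Otimes>\<^sub>M lborel)" by measurable
    show "integrable lborel (\<lambda>u. LINT t|lborel. cmod (case (u, t) of (u, t) \<Rightarrow> ?F u t))"
      using G by (simp add: norm_mult nH)
    show "AE u in lborel. integrable lborel (\<lambda>t. case (u, t) of (u, t) \<Rightarrow> ?F u t)"
      using H_aff by simp
  qed
  have inner: "(LINT u|lborel. ?F u t) = 2 * h t" for t
  proof -
    have "(LINT u|lborel. ?F u t) = (LINT s|lborel. ?F (t + 1 * s) t)"
      by (subst lborel_integral_real_affine[where c = 1 and t = t]) auto
    also have "\<dots> = (LINT s|lborel. exp ((\<mu> - \<nu>) * of_real t) * macdonald_integrand (\<mu> + \<nu>) (2 * cosh t * x) s)"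
    proof (intro Bochner_Integration.integral_cong refl)
      fix s
      have "x * cosh (t + s) + x * cosh (s - t) = 2 * cosh t * x * cosh s"
        by (simp add: cosh_add cosh_diff algebra_simps)
      then have "of_real (x * cosh (t + s)) + of_real (x * cosh (s - t)) = complex_of_real (2 * cosh t * x * cosh s)"
        by (simp only: flip: of_real_add)
      then have "\<mu> * of_real (t + s) - of_real (x * cosh (t + s)) + (\<nu> * of_real (s - t) - of_real (x * cosh (s - t)))
        = (\<mu> - \<nu>) * of_real t + ((\<mu> + \<nu>) * of_real s - complex_of_real (2 * cosh t * x * cosh s))"
        by (simp add: algebra_simps del: of_real_mult)
      then show "?F (t + 1 * s) t = exp ((\<mu> - \<nu>) * of_real t) * macdonald_integrand (\<mu> + \<nu>) (2 * cosh t * x) s"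
        unfolding macdonald_integrand_def by (simp flip: exp_add del: of_real_mult)
    qed
    also have "\<dots> = 2 * h t"
      unfolding h_def using x by (subst macdonald_eq_integral_real_line) auto
    finally show ?thesis .
  qed
  have "integrable lborel (\<lambda>t. 1/2 * (2 * h t))"
    using lborel_pair.integrable_snd[OF F] unfolding inner by (rule integrable_mult_right)
  then show "integrable lborel h" by simp
  have "2 * (LINT t|lborel. h t) = (LINT t|lborel. LINT u|lborel. ?F u t)"
    by (simp add: inner)
  also have "\<dots> = (LINT u|lborel. LINT t|lborel. ?F u t)"
    by (rule lborel_pair.Fubini_integral[OF F])
  also have "\<dots> = (LINT u|lborel. ?G u) * (LINT t|lborel. ?H t) / 2"
    by (simp add: iH)
  also have "\<dots> = 2 * (macdonald \<mu> (complex_of_real x) * macdonald \<nu> (complex_of_real x))"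
    using x by (simp add: macdonald_eq_integral_real_line)
  finally show "macdonald \<mu> (complex_of_real x) * macdonald \<nu> (complex_of_real x) = (LINT t|lborel. h t)"
    by simp
qed

section \<open>Decay of Fourier integrals\<close>

text \<open>
  The classical half-period shift: replacing \<open>t\<close> by \<open>t + pi/\<tau>\<close> changes the sign of the exponential, so
  twice the integral is the Fourier integral of \<open>h t - h (t + pi/\<tau>)\<close>. For a continuous \<open>h\<close> whose small
  translates have a common integrable majorant, dominated convergence finishes the proof; continuity of
  translation in \<open>L\<^sub>1\<close> is thereby avoided.
\<close>
lemma tendsto_fourier_integral_at_top:
  fixes h :: "real \<Rightarrow> complex"
  assumes cont: "continuous_on UNIV h" and w: "integrable lborel w"
    and dom: "\<And>t s. \<bar>s\<bar> \<le> 1 \<Longrightarrow> cmod (h (t + s)) \<le> w t"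
  shows "((\<lambda>\<tau>. LINT t|lborel. h t * exp (\<i> * of_real \<tau> * of_real t)) \<longlongrightarrow> 0) at_top"
proof -
  have [measurable]: "h \<in> borel_measurable borel"
    using cont by (rule borel_measurable_continuous_onI)
  have h: "integrable lborel h"
    using w by (rule Bochner_Integration.integrable_bound) (use dom[of 0] in \<open>auto intro: order_trans[OF _ abs_ge_self]\<close>)
  let ?d = "\<lambda>\<tau> t. cmod (h t - h (t + pi / \<tau>))"
  have shift: "((\<lambda>\<tau>. pi / \<tau>) \<longlongrightarrow> 0) at_top"
    by (intro tendsto_divide_0[OF tendsto_const] filterlim_at_top_imp_at_infinity filterlim_ident)
  have "((\<lambda>\<tau>. LINT t|lborel. ?d \<tau> t) \<longlongrightarrow> (LINT t::real|lborel. 0)) at_top"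
  proof (rule integral_dominated_convergence_at_top[where w = "\<lambda>t. 2 * w t"])
    show "integrable lborel (\<lambda>t. 2 * w t)" using w by simp
    show "\<forall>\<^sub>F \<tau> in at_top. AE t in lborel. norm (?d \<tau> t) \<le> 2 * w t"
    proof (rule eventually_mono[OF eventually_ge_at_top[of pi]], intro AE_I2)
      fix \<tau> t :: real assume "pi \<le> \<tau>"
      then have "0 < \<tau>" using pi_gt_zero by linarith
      then have "\<bar>pi / \<tau>\<bar> \<le> 1" using \<open>pi \<le> \<tau>\<close> by simp
      then show "norm (?d \<tau> t) \<le> 2 * w t"
        using dom[of 0 t] dom[of "pi / \<tau>" t] norm_triangle_ineq4[of "h t" "h (t + pi / \<tau>)"] by simp
    qed
    show "AE t in lborel. ((\<lambda>\<tau>. ?d \<tau> t) \<longlongrightarrow> 0) at_top"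
    proof (intro AE_I2)
      fix t
      have "isCont h t" using cont by (simp add: continuous_on_eq_continuous_at)
      then have "((\<lambda>\<tau>. h (t + pi / \<tau>)) \<longlongrightarrow> h t) at_top"
        using tendsto_add[OF tendsto_const[of t] shift] by (auto intro: isCont_tendsto_compose)
      from tendsto_norm[OF tendsto_diff[OF tendsto_const[of "h t"] this]]
      show "((\<lambda>\<tau>. ?d \<tau> t) \<longlongrightarrow> 0) at_top" by simp
    qed
  qed auto
  then have lim: "((\<lambda>\<tau>. LINT t|lborel. ?d \<tau> t) \<longlongrightarrow> 0) at_top" by simp
  show ?thesis
  proof (rule Lim_null_comparison[OF _ lim], rule eventually_mono[OF eventually_gt_at_top[of 0]])
    fix \<tau> :: real assume \<tau>: "0 < \<tau>"
    let ?e = "\<lambda>t. exp (\<i> * of_real \<tau> * of_real t)"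
    let ?I = "LINT t|lborel. h t * ?e t"
    have int: "integrable lborel (\<lambda>t. h t * ?e t)"
      by (rule Bochner_Integration.integrable_bound[OF h]) (auto simp: norm_mult)
    have h': "integrable lborel (\<lambda>t. h (t + pi / \<tau>))"
      using lborel_integrable_real_affine[OF h, of 1 "pi / \<tau>"] by (simp add: add.commute)
    have int': "integrable lborel (\<lambda>t. h (t + pi / \<tau>) * ?e t)"
      by (rule Bochner_Integration.integrable_bound[OF h']) (auto simp: norm_mult)
    have "?I = (LINT t|lborel. h (t + pi / \<tau>) * ?e (t + pi / \<tau>))"
      by (subst lborel_integral_real_affine[where c = 1 and t = "pi / \<tau>"]) (auto simp: add.commute)
    also have "\<dots> = (LINT t|lborel. h (t + pi / \<tau>) * (- ?e t))"
    proof (intro Bochner_Integration.integral_cong refl)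
      fix t
      have "\<i> * of_real \<tau> * of_real (t + pi / \<tau>) = \<i> * of_real \<tau> * of_real t + \<i> * of_real pi"
        using \<tau> by (simp add: field_simps)
      then show "h (t + pi / \<tau>) * ?e (t + pi / \<tau>) = h (t + pi / \<tau>) * (- ?e t)"
        by (simp only: exp_add exp_pi_i') simp
    qed
    finally have "2 * ?I = ?I - (LINT t|lborel. h (t + pi / \<tau>) * ?e t)" by simp
    also have "\<dots> = (LINT t|lborel. (h t - h (t + pi / \<tau>)) * ?e t)"
      using int int' by (simp add: left_diff_distrib)
    finally have "2 * cmod ?I = cmod (LINT t|lborel. (h t - h (t + pi / \<tau>)) * ?e t)"
      by (metis norm_mult norm_numeral)
    also have "\<dots> \<le> (LINT t|lborel. cmod ((h t - h (t + pi / \<tau>)) * ?e t))"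
      by (rule integral_norm_bound)
    also have "\<dots> = (LINT t|lborel. ?d \<tau> t)" by (simp add: norm_mult)
    finally show "cmod ?I \<le> (LINT t|lborel. ?d \<tau> t)" using norm_ge_zero[of ?I] by linarith
  qed
qed

section \<open>The index kernel\<close>

text \<open>
  This supplies the common majorant of small translates of \<open>exp (\<alpha> u/2 - x cosh u)\<close>: the same integrand, up
  to a constant factor, with \<open>x\<close> replaced by \<open>x/e\<close>.
\<close>
lemma cosh_shift_ge:
  assumes "\<bar>s\<bar> \<le> 1"
  shows "exp (-1) * cosh t \<le> cosh (t + s :: real)"
proof -
  have "exp (-1) * exp t \<le> exp (t + s)" "exp (-1) * exp (- t) \<le> exp (- (t + s))"
    using assms by (auto simp flip: exp_add)
  then show ?thesis by (simp add: cosh_def algebra_simps)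
qed

lemma index_kernel_bounds:
  assumes "x > 0"
  shows "0 \<le> index_kernel \<alpha> \<tau> x" "index_kernel \<alpha> \<tau> x \<le> (macdonald (\<alpha>/2) x)\<^sup>2"
  using norm_macdonald_le[OF assms, of "(\<i> * complex_of_real \<tau> + complex_of_real \<alpha>) / 2"]
  unfolding index_kernel_def by (auto intro: power_mono)

text \<open>
  Changing the sign of \<open>\<tau>\<close> conjugates the order and therefore the value. Evenness reduces the limit at
  infinity to the one at plus infinity.
\<close>
lemma index_kernel_minus:
  assumes "x > 0"
  shows "index_kernel \<alpha> (- \<tau>) x = index_kernel \<alpha> \<tau> x"
proof -
  have "cnj ((\<i> * complex_of_real \<tau> + complex_of_real \<alpha>) / 2) = (\<i> * complex_of_real (- \<tau>) + complex_of_real \<alpha>) / 2"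
    by simp
  then show ?thesis
    unfolding index_kernel_def
    using cnj_macdonald[OF assms, of "(\<i> * complex_of_real \<tau> + complex_of_real \<alpha>) / 2"]
    by (metis complex_mod_cnj)
qed

lemma borel_measurable_index_kernel [measurable]: "index_kernel \<alpha> \<tau> \<in> borel_measurable borel"
  unfolding index_kernel_def by measurable

text \<open>
  The product formula for an order and its conjugate, whose sum is \<open>\<alpha>\<close> and whose difference is \<open>\<i>\<tau>\<close>.
\<close>
lemma index_kernel_eq_fourier:
  assumes "x > 0"
  shows "complex_of_real (index_kernel \<alpha> \<tau> x) =
    (LINT t|lborel. complex_of_real (macdonald \<alpha> (2 * cosh t * x)) * exp (\<i> * of_real \<tau> * of_real t))"
    and "integrable lborel (\<lambda>t. complex_of_real (macdonald \<alpha> (2 * cosh t * x)) * exp (\<i> * of_real \<tau> * of_real t))"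
proof -
  let ?m = "(\<i> * complex_of_real \<tau> + complex_of_real \<alpha>) / 2"
  have sum: "?m + cnj ?m = complex_of_real \<alpha>" and diff: "?m - cnj ?m = \<i> * of_real \<tau>"
    by (simp_all add: complex_eq_iff)
  note prod = macdonald_mult_macdonald[OF assms, of ?m "cnj ?m", unfolded sum diff macdonald_of_real]
  have "complex_of_real (index_kernel \<alpha> \<tau> x) = macdonald ?m (of_real x) * macdonald (cnj ?m) (of_real x)"
    unfolding index_kernel_def complex_norm_square using cnj_macdonald[OF assms, of ?m] by simp
  then show "complex_of_real (index_kernel \<alpha> \<tau> x) =
    (LINT t|lborel. complex_of_real (macdonald \<alpha> (2 * cosh t * x)) * exp (\<i> * of_real \<tau> * of_real t))"
    using prod(2) by simp
  show "integrable lborel (\<lambda>t. complex_of_real (macdonald \<alpha> (2 * cosh t * x)) * exp (\<i> * of_real \<tau> * of_real t))"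
    using prod(1) .
qed

text \<open>
  The order enters \<open>K\<^bsub>(\<i>\<tau>+\<alpha>)/2\<^esub>(x)\<close> through the factor \<open>exp (\<i>\<tau>u/2)\<close>, so this function of \<open>\<tau>\<close> is a Fourier
  integral at frequency \<open>\<tau>/2\<close>.
\<close>
lemma index_kernel_tendsto_0:
  assumes x: "x > 0"
  shows "((\<lambda>\<tau>. index_kernel \<alpha> \<tau> x) \<longlongrightarrow> 0) at_top"
proof -
  let ?h = "\<lambda>u. complex_of_real (macdonald_integrand (\<alpha>/2) x u)"
  have "((\<lambda>\<tau>. LINT t|lborel. ?h t * exp (\<i> * of_real \<tau> * of_real t)) \<longlongrightarrow> 0) at_top"
  proof (rule tendsto_fourier_integral_at_top)
    show "continuous_on UNIV ?h" by (intro continuous_intros continuous_on_macdonald_integrand)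
    show "integrable lborel (\<lambda>t. exp \<bar>\<alpha>/2\<bar> * macdonald_integrand (\<alpha>/2) (x * exp (-1)) t)"
      using x by (intro integrable_mult_right integrable_macdonald_integrand) simp
    fix t s :: real assume s: "\<bar>s\<bar> \<le> 1"
    have "\<alpha>/2 * s \<le> \<bar>\<alpha>/2\<bar> * 1"
      using mult_left_mono[OF s abs_ge_zero[of "\<alpha>/2"]] abs_ge_self[of "\<alpha>/2 * s"]
      unfolding abs_mult by linarith
    moreover have "x * (exp (-1) * cosh t) \<le> x * cosh (t + s)"
      using x cosh_shift_ge[OF s] by (intro mult_left_mono) auto
    ultimately have "\<alpha>/2 * (t + s) - x * cosh (t + s) \<le> \<bar>\<alpha>/2\<bar> + (\<alpha>/2 * t - x * exp (-1) * cosh t)"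
      unfolding distrib_left mult.assoc by linarith
    then show "cmod (?h (t + s)) \<le> exp \<bar>\<alpha>/2\<bar> * macdonald_integrand (\<alpha>/2) (x * exp (-1)) t"
      unfolding macdonald_integrand_def exp_add[symmetric] norm_of_real abs_exp_cancel by simp
  qed
  moreover have "filterlim (\<lambda>\<tau>::real. 1/2 * \<tau>) at_top at_top"
    by (rule filterlim_tendsto_pos_mult_at_top[OF tendsto_const _ filterlim_ident]) simp
  ultimately have "((\<lambda>\<tau>. LINT t|lborel. ?h t * exp (\<i> * of_real (1/2 * \<tau>) * of_real t)) \<longlongrightarrow> 0) at_top"
    by (rule filterlim_compose)
  also have "(\<lambda>\<tau>. LINT t|lborel. ?h t * exp (\<i> * of_real (1/2 * \<tau>) * of_real t)) =
      (\<lambda>\<tau>. LINT t|lborel. macdonald_integrand ((\<i> * complex_of_real \<tau> + complex_of_real \<alpha>) / 2) x t)"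
  proof (intro ext Bochner_Integration.integral_cong refl)
    fix \<tau> t
    have "complex_of_real (\<alpha>/2 * t - x * cosh t) + \<i> * of_real (1/2 * \<tau>) * of_real t =
        (\<i> * complex_of_real \<tau> + complex_of_real \<alpha>) / 2 * of_real t - of_real (x * cosh t)"
      by (simp add: field_simps)
    then show "?h t * exp (\<i> * of_real (1/2 * \<tau>) * of_real t) =
        macdonald_integrand ((\<i> * complex_of_real \<tau> + complex_of_real \<alpha>) / 2) x t"
      unfolding macdonald_integrand_def of_real_eq_id id_apply exp_of_real[symmetric] exp_add[symmetric]
      by (rule arg_cong)
  qed
  finally have "((\<lambda>\<tau>. macdonald ((\<i> * complex_of_real \<tau> + complex_of_real \<alpha>) / 2) (of_real x)) \<longlongrightarrow> 0 / 2) at_top"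
    unfolding macdonald_eq_integral_real_line[OF x] by (rule tendsto_divide) auto
  from tendsto_power[OF tendsto_norm[OF this], of 2] show ?thesis
    unfolding index_kernel_def by simp
qed

section \<open>Joint integrability and the composition representation\<close>

text \<open>
  Elements of \<open>L\<^sup>\<alpha>\<close> are only Lebesgue measurable, whereas everything that depends on \<open>t\<close> is Borel. Fubini's theorem is
  therefore used on the product of the completed measure in \<open>x\<close> with the Borel measure in \<open>t\<close>, which requires
  the completion to be sigma-finite.
\<close>
lemma sigma_finite_completion:
  assumes "sigma_finite_measure M"
  shows "sigma_finite_measure (completion M)"
proof
  from assms obtain A where "countable A" "A \<subseteq> sets M" "\<Union>A = space M" "\<forall>a\<in>A. emeasure M a \<noteq> \<infinity>"
    unfolding sigma_finite_measure_def by blast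
  then show "\<exists>A. countable A \<and> A \<subseteq> sets (completion M) \<and> \<Union>A = space (completion M) \<and>
      (\<forall>a\<in>A. emeasure (completion M) a \<noteq> \<infinity>)"
    by (intro exI[of _ A]) (auto simp: sets_completionI_sets subset_iff)
qed

interpretation lebesgue_lborel: pair_sigma_finite "lebesgue :: real measure" "lborel :: real measure"
  by (intro pair_sigma_finite.intro sigma_finite_completion sigma_finite_lborel)

lemma index_kernel_0:
  "index_kernel \<alpha> 0 x = (macdonald (\<alpha>/2) x)\<^sup>2"
  using macdonald_of_real[of "\<alpha>/2" x] by (simp add: index_kernel_def)

text \<open>
  The case \<open>\<tau> = 0\<close> of the Fourier representation; it explains the weight in the norm of \<open>L\<^sup>\<alpha>\<close>.
\<close>
lemma integral_macdonald_cosh: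
  fixes \<alpha> x :: real
  assumes "x > 0"
  shows "integrable lborel (\<lambda>t. macdonald \<alpha> (2 * cosh t * x))"
    and "(LINT t|lborel. macdonald \<alpha> (2 * cosh t * x)) = (macdonald (\<alpha>/2) x)\<^sup>2"
proof -
  show "integrable lborel (\<lambda>t. macdonald \<alpha> (2 * cosh t * x))"
    using index_kernel_eq_fourier(2)[OF assms, of \<alpha> 0] by (simp add: complex_of_real_integrable_eq)
  have "complex_of_real ((macdonald (\<alpha>/2) x)\<^sup>2) = complex_of_real (LINT t|lborel. macdonald \<alpha> (2 * cosh t * x))"
    using index_kernel_eq_fourier(1)[OF assms, of \<alpha> 0] unfolding index_kernel_0
    by (simp del: of_real_power)
  then show "(LINT t|lborel. macdonald \<alpha> (2 * cosh t * x)) = (macdonald (\<alpha>/2) x)\<^sup>2"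
    unfolding of_real_eq_iff by simp
qed

lemma L_space_measurable:
  assumes "f \<in> L_space \<alpha>"
  shows "(\<lambda>x. indicator {0<..} x *\<^sub>R f x) \<in> borel_measurable lebesgue"
  using assms unfolding L_space_def set_borel_measurable_def by simp

lemma L_space_integrable:
  assumes "f \<in> L_space \<alpha>"
  shows "integrable lebesgue (\<lambda>x. indicator {0<..} x * ((macdonald (\<alpha>/2) x)\<^sup>2 * cmod (f x)))"
  using assms unfolding L_space_def set_integrable_def by simp

text \<open>
  As \<open>K\<^sub>\<alpha>\<close> is nonnegative, integrating the modulus over \<open>t\<close> first gives precisely \<open>K\<^bsub>\<alpha>/2\<^esub>(x)\<^sup>2 |f(x)|\<close>. The oscillating
  factor is kept so that the same fact serves the existence of \<open>h\<close> (at \<open>\<tau> = 0\<close>) and the exchange of integrals.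
\<close>
lemma integrable_pair_macdonald_cosh:
  assumes f: "f \<in> L_space \<alpha>"
  shows "integrable (lebesgue \<Otimes>\<^sub>M lborel) (\<lambda>(x, t).
    indicator {0<..} x *\<^sub>R (complex_of_real (macdonald \<alpha> (2 * cosh t * x)) * f x)
      * exp (\<i> * of_real \<tau> * of_real t))"
    (is "integrable _ (\<lambda>(x, t). ?\<Phi> x t)")
proof (rule lebesgue_lborel.Fubini_integrable)
  note [measurable] = L_space_measurable[OF f]
  have [measurable]: "(\<lambda>x. x) \<in> lebesgue \<rightarrow>\<^sub>M (borel :: real measure)"
    by (rule measurable_completion) simp
  have [measurable]: "fst \<in> lebesgue \<Otimes>\<^sub>M lborel \<rightarrow>\<^sub>M (borel :: real measure)"
    by (rule measurable_compose[OF measurable_fst]) measurable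
  \<comment> \<open>The indicator is moved next to \<open>f\<close>, since only their product is known to be measurable.\<close>
  have "(\<lambda>p. complex_of_real (macdonald \<alpha> (2 * cosh (snd p) * fst p)) * (indicator {0<..} (fst p) *\<^sub>R f (fst p))
      * exp (\<i> * of_real \<tau> * of_real (snd p))) \<in> borel_measurable (lebesgue \<Otimes>\<^sub>M lborel)"
    unfolding cosh_def by measurable
  then show "(\<lambda>(x, t). ?\<Phi> x t) \<in> borel_measurable (lebesgue \<Otimes>\<^sub>M lborel)"
    by (simp add: case_prod_beta')
  have norm: "cmod (?\<Phi> x t) = indicator {0<..} x * (macdonald \<alpha> (2 * cosh t * x) * cmod (f x))" for x t
    using macdonald_nonneg[of "2 * cosh t * x" \<alpha>] by (auto simp: indicator_def norm_mult)
  have "(LINT t|lborel. cmod (?\<Phi> x t)) = indicator {0<..} x * ((macdonald (\<alpha>/2) x)\<^sup>2 * cmod (f x))" for x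
    unfolding norm using integral_macdonald_cosh(2)[of x \<alpha>] by (simp add: indicator_def)
  then show "integrable lebesgue (\<lambda>x. LINT t|lborel. cmod (case (x, t) of (x, t) \<Rightarrow> ?\<Phi> x t))"
    using L_space_integrable[OF f] by (simp only: prod.case)
  have "integrable lborel (?\<Phi> x)" for x
  proof (cases "x > 0")
    case True
    from integrable_mult_right[OF index_kernel_eq_fourier(2)[OF True, of \<alpha> \<tau>], of "f x"]
    show ?thesis using True by (simp add: mult_ac)
  qed simp
  then show "AE x in lebesgue. integrable lborel (\<lambda>t. case (x, t) of (x, t) \<Rightarrow> ?\<Phi> x t)"
    by simp
qed

lemma set_integrable_index_kernel:
  assumes f: "f \<in> L_space \<alpha>"
  shows "set_integrable lebesgue {0<..} (\<lambda>x. complex_of_real (index_kernel \<alpha> \<tau> x) * f x)"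
  unfolding set_integrable_def
proof (rule Bochner_Integration.integrable_bound[OF L_space_integrable[OF f]])
  note [measurable] = L_space_measurable[OF f]
  have [measurable]: "index_kernel \<alpha> \<tau> \<in> borel_measurable lebesgue"
    by (rule measurable_completion) simp
  have "(\<lambda>x. complex_of_real (index_kernel \<alpha> \<tau> x) * (indicator {0<..} x *\<^sub>R f x)) \<in> borel_measurable lebesgue"
    by measurable
  then show "(\<lambda>x. indicator {0<..} x *\<^sub>R (complex_of_real (index_kernel \<alpha> \<tau> x) * f x)) \<in> borel_measurable lebesgue"
    by simp
  show "AE x in lebesgue. cmod (indicator {0<..} x *\<^sub>R (complex_of_real (index_kernel \<alpha> \<tau> x) * f x))
      \<le> norm (indicator {0<..} x * ((macdonald (\<alpha>/2) x)\<^sup>2 * cmod (f x)))"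
    using index_kernel_bounds[of _ \<alpha> \<tau>] by (auto simp: indicator_def norm_mult intro!: mult_right_mono)
qed

lemma set_integrable_meijer:
  assumes f: "f \<in> L_space \<alpha>"
  shows "AE t in lebesgue. set_integrable lebesgue {0<..}
    (\<lambda>x. complex_of_real (macdonald \<alpha> (2 * cosh t * x)) * f x)"
  using lebesgue_lborel.AE_integrable_snd[OF integrable_pair_macdonald_cosh[OF f, of 0]]
  unfolding set_integrable_def AE_completion_iff by simp

lemma integrable_meijer:
  assumes f: "f \<in> L_space \<alpha>"
  shows "integrable lborel (\<lambda>t. meijer_K_transform \<alpha> f (2 * cosh t))"
  using lebesgue_lborel.integrable_snd[OF integrable_pair_macdonald_cosh[OF f, of 0]]
  unfolding meijer_K_transform_def set_lebesgue_integral_def by simp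

lemma index_transform_eq_fourier:
  assumes f: "f \<in> L_space \<alpha>"
  shows "index_transform \<alpha> f \<tau> = fourier_transform (\<lambda>t. meijer_K_transform \<alpha> f (2 * cosh t)) \<tau>"
proof -
  let ?e = "\<lambda>t. exp (\<i> * complex_of_real \<tau> * complex_of_real t)"
  let ?\<Phi> = "\<lambda>x t. indicator {0<..} x *\<^sub>R (complex_of_real (macdonald \<alpha> (2 * cosh t * x)) * f x) * ?e t"
  have "(LINT t|lborel. ?\<Phi> x t) = indicator {0<..} x *\<^sub>R (complex_of_real (index_kernel \<alpha> \<tau> x) * f x)" for x
  proof (cases "x > 0")
    case True
    then have "(LINT t|lborel. ?\<Phi> x t) = (LINT t|lborel. complex_of_real (macdonald \<alpha> (2 * cosh t * x)) * ?e t * f x)"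
      by (simp add: mult_ac)
    then show ?thesis
      using True by (simp add: index_kernel_eq_fourier(1))
  qed simp
  then have "index_transform \<alpha> f \<tau> = (LINT x|lebesgue. LINT t|lborel. ?\<Phi> x t)"
    unfolding index_transform_def set_lebesgue_integral_def by presburger
  also have "\<dots> = (LINT t|lborel. LINT x|lebesgue. ?\<Phi> x t)"
    by (rule lebesgue_lborel.Fubini_integral[OF integrable_pair_macdonald_cosh[OF f], symmetric])
  also have "\<dots> = (LINT t|lborel. meijer_K_transform \<alpha> f (2 * cosh t) * ?e t)"
    unfolding meijer_K_transform_def set_lebesgue_integral_def by (simp only: integral_mult_left_zero)
  also have "\<dots> = fourier_transform (\<lambda>t. meijer_K_transform \<alpha> f (2 * cosh t)) \<tau>"
    unfolding fourier_transform_def using borel_measurable_integrable[OF integrable_meijer[OF f]]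
    by (subst integral_completion) simp_all
  finally show ?thesis .
qed

section \<open>Continuity, boundedness and decay of the transform\<close>

lemma continuous_on_fourier_transform:
  assumes h: "integrable lborel h"
  shows "continuous_on UNIV (fourier_transform h)"
proof -
  have [measurable]: "h \<in> borel_measurable borel"
    using borel_measurable_integrable[OF h] by simp
  have eq: "fourier_transform h = (\<lambda>\<tau>. LINT t|lborel. h t * exp (\<i> * of_real \<tau> * of_real t))"
    unfolding fourier_transform_def by (intro ext integral_completion) simp
  show ?thesis
    unfolding continuous_on_sequentially eq comp_def
  proof (intro allI ballI impI)
    fix \<tau> :: "nat \<Rightarrow> real" and a
    assume "(\<forall>n. \<tau> n \<in> UNIV) \<and> \<tau> \<longlonglongrightarrow> a"
    then have \<tau>: "\<tau> \<longlonglongrightarrow> a" by simp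
    show "(\<lambda>n. LINT t|lborel. h t * exp (\<i> * of_real (\<tau> n) * of_real t))
        \<longlonglongrightarrow> (LINT t|lborel. h t * exp (\<i> * of_real a * of_real t))"
      by (rule integral_dominated_convergence[where w = "\<lambda>t. cmod (h t)"])
         (use h in \<open>auto simp: norm_mult intro!: tendsto_intros \<tau>\<close>)
  qed
qed

lemma norm_index_transform_le:
  assumes f: "f \<in> L_space \<alpha>"
  shows "cmod (index_transform \<alpha> f \<tau>) \<le> L_norm \<alpha> f"
  unfolding index_transform_def L_norm_def set_lebesgue_integral_def
proof (rule order_trans[OF integral_norm_bound Bochner_Integration.integral_mono])
  show "integrable lebesgue (\<lambda>x. cmod (indicator {0<..} x *\<^sub>R (complex_of_real (index_kernel \<alpha> \<tau> x) * f x)))"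
    using set_integrable_index_kernel[OF f, of \<tau>] unfolding set_integrable_def
    by (rule Bochner_Integration.integrable_norm)
  show "integrable lebesgue (\<lambda>x. indicator {0<..} x *\<^sub>R ((macdonald (\<alpha>/2) x)\<^sup>2 * cmod (f x)))"
    using L_space_integrable[OF f] by simp
  show "cmod (indicator {0<..} x *\<^sub>R (complex_of_real (index_kernel \<alpha> \<tau> x) * f x))
      \<le> indicator {0<..} x *\<^sub>R ((macdonald (\<alpha>/2) x)\<^sup>2 * cmod (f x))" for x
    using index_kernel_bounds[of x \<alpha> \<tau>] by (auto simp: indicator_def norm_mult intro!: mult_right_mono)
qed

text \<open>
  Dominated convergence with the pointwise decay of the kernel and the majorant \<open>K\<^bsub>\<alpha>/2\<^esub>(x)\<^sup>2 |f(x)|\<close>.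
\<close>
lemma index_transform_tendsto_0:
  assumes f: "f \<in> L_space \<alpha>"
  shows "(index_transform \<alpha> f \<longlongrightarrow> 0) at_infinity"
proof -
  let ?s = "\<lambda>\<tau> x. indicator {0<..} x *\<^sub>R (complex_of_real (index_kernel \<alpha> \<tau> x) * f x)"
  have "((\<lambda>\<tau>. LINT x|lebesgue. ?s \<tau> x) \<longlongrightarrow> (LINT x::real|lebesgue. 0)) at_top"
  proof (rule integral_dominated_convergence_at_top)
    show "?s \<tau> \<in> borel_measurable lebesgue" for \<tau>
      using set_integrable_index_kernel[OF f, of \<tau>] unfolding set_integrable_def by (rule borel_measurable_integrable)
    show "integrable lebesgue (\<lambda>x. indicator {0<..} x * ((macdonald (\<alpha>/2) x)\<^sup>2 * cmod (f x)))"
      using f by (rule L_space_integrable)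
    have "((\<lambda>\<tau>. ?s \<tau> x) \<longlongrightarrow> 0) at_top" for x
    proof (cases "x > 0")
      case True
      from tendsto_mult[OF tendsto_of_real[OF index_kernel_tendsto_0[OF True, of \<alpha>]] tendsto_const[of "f x"]]
      show ?thesis using True by simp
    qed simp
    then show "AE x in lebesgue. ((\<lambda>\<tau>. ?s \<tau> x) \<longlongrightarrow> 0) at_top" by simp
    show "\<forall>\<^sub>F \<tau> in at_top. AE x in lebesgue. cmod (?s \<tau> x)
        \<le> indicator {0<..} x * ((macdonald (\<alpha>/2) x)\<^sup>2 * cmod (f x))"
      using index_kernel_bounds
      by (intro always_eventually) (auto simp: indicator_def norm_mult intro!: mult_right_mono)
  qed simp
  then have top: "(index_transform \<alpha> f \<longlongrightarrow> 0) at_top"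
    unfolding index_transform_def[abs_def] set_lebesgue_integral_def by simp
  have even: "index_transform \<alpha> f (- \<tau>) = index_transform \<alpha> f \<tau>" for \<tau>
    unfolding index_transform_def set_lebesgue_integral_def
    by (intro Bochner_Integration.integral_cong) (auto simp: indicator_def index_kernel_minus)
  show ?thesis
    unfolding at_infinity_eq_at_top_bot
    by (intro filterlim_sup) (use top in \<open>simp_all add: filterlim_at_bot_mirror even\<close>)
qed

section \<open>The mapping theorem\<close>

theorem theorem1:
  fixes \<alpha> :: real
  assumes "\<alpha> \<ge> 0"
  shows "(\<forall>f\<in>L_space \<alpha>. \<forall>\<tau>.
            set_integrable lebesgue {0<..} (\<lambda>x. complex_of_real (index_kernel \<alpha> \<tau> x) * f x)) \<and>
         bounded_operator (L_space \<alpha>) (L_norm \<alpha>) C0_space sup_norm (index_transform \<alpha>) \<and>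
         (\<forall>f\<in>L_space \<alpha>.
            (AE t in lebesgue. set_integrable lebesgue {0<..}
               (\<lambda>x. complex_of_real (macdonald \<alpha> (2 * cosh t * x)) * f x)) \<and>
            integrable lebesgue (\<lambda>t. meijer_K_transform \<alpha> f (2 * cosh t)) \<and>
            (\<forall>\<tau>. index_transform \<alpha> f \<tau> =
               fourier_transform (\<lambda>t. meijer_K_transform \<alpha> f (2 * cosh t)) \<tau>))"
proof (intro conjI ballI allI)
  fix f \<tau> assume f: "f \<in> L_space \<alpha>"
  show "set_integrable lebesgue {0<..} (\<lambda>x. complex_of_real (index_kernel \<alpha> \<tau> x) * f x)"
    using f by (rule set_integrable_index_kernel)
  show "AE t in lebesgue. set_integrable lebesgue {0<..}
      (\<lambda>x. complex_of_real (macdonald \<alpha> (2 * cosh t * x)) * f x)"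
    using f by (rule set_integrable_meijer)
  show "integrable lebesgue (\<lambda>t. meijer_K_transform \<alpha> f (2 * cosh t))"
    using integrable_meijer[OF f] by (simp add: integrable_completion borel_measurable_integrable)
  show "index_transform \<alpha> f \<tau> = fourier_transform (\<lambda>t. meijer_K_transform \<alpha> f (2 * cosh t)) \<tau>"
    using f by (rule index_transform_eq_fourier)
next
  show "bounded_operator (L_space \<alpha>) (L_norm \<alpha>) C0_space sup_norm (index_transform \<alpha>)"
    unfolding bounded_operator_def
  proof (intro conjI ballI allI)
    fix f assume f: "f \<in> L_space \<alpha>"
    have "continuous_on UNIV (index_transform \<alpha> f)"
      using continuous_on_fourier_transform[OF integrable_meijer[OF f]] index_transform_eq_fourier[OF f]
      by (simp cong: continuous_on_cong)
    then show "index_transform \<alpha> f \<in> C0_space"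
      using index_transform_tendsto_0[OF f] norm_index_transform_le[OF f]
      unfolding C0_space_def bcontfun_def by (auto intro!: boundedI)
  next
    fix f g a b assume f: "f \<in> L_space \<alpha>" and g: "g \<in> L_space \<alpha>"
    show "index_transform \<alpha> (\<lambda>x. a * f x + b * g x) =
        (\<lambda>\<tau>. a * index_transform \<alpha> f \<tau> + b * index_transform \<alpha> g \<tau>)"
    proof
      fix \<tau>
      let ?k = "\<lambda>x. complex_of_real (index_kernel \<alpha> \<tau> x)"
      have "index_transform \<alpha> (\<lambda>x. a * f x + b * g x) \<tau>
          = (LINT x:{0<..}|lebesgue. a * (?k x * f x) + b * (?k x * g x))"
        unfolding index_transform_def by (simp add: algebra_simps)
      also have "\<dots> = a * index_transform \<alpha> f \<tau> + b * index_transform \<alpha> g \<tau>"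
        using set_integrable_index_kernel[OF f, of \<tau>] set_integrable_index_kernel[OF g, of \<tau>]
        unfolding index_transform_def by simp
      finally show "index_transform \<alpha> (\<lambda>x. a * f x + b * g x) \<tau>
          = a * index_transform \<alpha> f \<tau> + b * index_transform \<alpha> g \<tau>" .
    qed
  next
    have "sup_norm (index_transform \<alpha> f) \<le> 1 * L_norm \<alpha> f" if "f \<in> L_space \<alpha>" for f
      unfolding sup_norm_def using norm_index_transform_le[OF that] by (auto intro: cSUP_least)
    then show "\<exists>C. \<forall>f\<in>L_space \<alpha>. sup_norm (index_transform \<alpha> f) \<le> C * L_norm \<alpha> f"
      by blast
  qed
qed

end
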